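(* Let $k\ge 2$ and let $G=K_{n_1,n_2,\ldots,n_k}$ be the complete $k$-partite graph on $n=n_1+\cdots+n_k$ vertices, where $n_i\ge 3$ for each $1\le i\le k$. Then $\gamma_I^p(G)=4$ if $k=2$, $\gamma_I^p(G)=3$ if $k=3$, and $\gamma_I^p(G)=n$ if $k\ge 4$.
   Context: For a graph $G=(V,E)$ and $v\in V$, $N(v)$ denotes the set of neighbours of $v$. A perfect Italian dominating function (PID-function) of $G$ is a function $f:V\to\{0,1,2\}$ such that for every vertex $v$ with $f(v)=0$ one has $\sum_{u\in N(v)} f(u)=2$. The weight of $f$ is $\sum_{v\in V} f(v)$; $\gamma_I^p(G)$ is the minimum weight of a PID-function of $G$. *)

theory Defs
  imports "Graph_Theory.Digraph" "HOL-Library.FuncSet" "HOL-Library.Disjoint_Sets"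
begin

text \<open>Finite simple graphs are symmetric digraphs without loops and multiple arcs,
  i.e. instances of the locale \<^locale>\<open>graph\<close>.\<close>

definition neighbours :: "('a, 'b) pre_digraph \<Rightarrow> 'a \<Rightarrow> 'a set" where
  "neighbours G v = {u \<in> verts G. v \<rightarrow>\<^bsub>G\<^esub> u}"

text \<open>Only the values on the vertex set matter; \<open>f\<close> is arbitrary elsewhere.\<close>
definition pid_function :: "('a, 'b) pre_digraph \<Rightarrow> ('a \<Rightarrow> nat) \<Rightarrow> bool" where
  "pid_function G f \<longleftrightarrow>
     f \<in> verts G \<rightarrow> {0, 1, 2} \<and>
     (\<forall>v\<in>verts G. f v = 0 \<longrightarrow> (\<Sum>u\<in>neighbours G v. f u) = 2)"

definition weight :: "('a, 'b) pre_digraph \<Rightarrow> ('a \<Rightarrow> nat) \<Rightarrow> nat" where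
  "weight G f = (\<Sum>v\<in>verts G. f v)"

definition pid_number :: "('a, 'b) pre_digraph \<Rightarrow> nat" where
  "pid_number G = (LEAST w. \<exists>f. pid_function G f \<and> weight G f = w)"

text \<open>The least element exists because the constant function 1 is always a PID-function.\<close>
lemma pid_number_attained: "\<exists>f. pid_function G f \<and> weight G f = pid_number G"
  unfolding pid_number_def
proof (rule LeastI_ex)
  have "pid_function G (\<lambda>_. 1)"
    by (auto simp: pid_function_def)
  then show "\<exists>w f. pid_function G f \<and> weight G f = w"
    by blast
qed

lemma pid_number_le: "pid_function G f \<Longrightarrow> pid_number G \<le> weight G f"
  unfolding pid_number_def by (rule Least_le) blast

text \<open>The multipartite analogue of the library's \<open>complete_bipartite_digraph\<close>:
  \<open>G\<close> is a copy of the complete \<open>k\<close>-partite graph with parts \<open>P 1, \<dots>, P k\<close>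
  of sizes \<open>n 1, \<dots>, n k\<close>.\<close>
definition complete_multipartite_digraph ::
    "nat \<Rightarrow> (nat \<Rightarrow> nat) \<Rightarrow> ('a, 'b) pre_digraph \<Rightarrow> bool" where
  "complete_multipartite_digraph k n G \<longleftrightarrow> graph G \<and>
     (\<exists>P. verts G = (\<Union>i\<in>{1..k}. P i) \<and> disjoint_family_on P {1..k} \<and>
          (\<forall>i\<in>{1..k}. card (P i) = n i) \<and>
          arcs_ends G = (\<Union>i\<in>{1..k}. \<Union>j\<in>{1..k} - {i}. P i \<times> P j))"

end

theory Submission
  imports Defs
begin

text \<open>In a complete multipartite graph the neighbourhood of a vertex of part \<open>i\<close> is everything
  outside that part, so a zero of a PID-function \<open>f\<close> in part \<open>i\<close> forces the values of \<open>f\<close> outside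
  part \<open>i\<close> to sum to 2. Since every other part has at least three vertices, it then also contains
  a zero. Hence either \<open>f\<close> has no zeros and weight at least \<open>n\<close>, or every part satisfies the
  equation \<open>w = S\<^sub>i + 2\<close>, where \<open>w\<close> is the weight and \<open>S\<^sub>i\<close> the sum over part \<open>i\<close>; summing over the
  \<open>k\<close> parts gives \<open>(k - 1) w = 2 k\<close>, which determines \<open>w\<close> for \<open>k \<le> 3\<close> and has no solution for
  \<open>k \<ge> 4\<close>.\<close>

text \<open>An abstract finite index set lets the argument see only the number of parts. Part sizes
  enter through the bound 3, one more than the weight 2 that a zero demands of its
  neighbourhood.\<close>

locale large_multipartite =
  fixes G :: "('a, 'b) pre_digraph" and I :: "'i set" and P :: "'i \<Rightarrow> 'a set"
  assumes finite_index: "finite I"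
    and card_part: "i \<in> I \<Longrightarrow> card (P i) \<ge> 3"
    and disjoint: "disjoint_family_on P I"
    and verts_eq: "verts G = (\<Union>i\<in>I. P i)"
    and arcs_ends_eq: "arcs_ends G = (\<Union>i\<in>I. \<Union>j\<in>I - {i}. P i \<times> P j)"
begin

lemma finite_part: "i \<in> I \<Longrightarrow> finite (P i)"
  using card_part[of i] card.infinite[of "P i"] by fastforce

lemma finite_verts: "finite (verts G)"
  by (simp add: verts_eq finite_index finite_part)

lemma part_unique: "v \<in> P i \<Longrightarrow> v \<in> P j \<Longrightarrow> i \<in> I \<Longrightarrow> j \<in> I \<Longrightarrow> i = j"
  using disjoint unfolding disjoint_family_on_def by blast

lemma neighbours_eq:
  assumes "i \<in> I" "v \<in> P i"
  shows "neighbours G v = verts G - P i"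
  using assms part_unique unfolding neighbours_def arcs_ends_eq verts_eq by blast

lemma sum_verts: "sum g (verts G) = (\<Sum>i\<in>I. sum g (P i))"
  unfolding verts_eq
  by (rule sum.UNION_disjoint) (use finite_index finite_part part_unique in blast)+

lemma weight_eq_part_plus_neighbours:
  assumes "i \<in> I" "v \<in> P i"
  shows "weight G f = sum f (P i) + sum f (neighbours G v)"
proof -
  have "P i \<subseteq> verts G"
    using assms by (auto simp: verts_eq)
  then show ?thesis
    using sum.subset_diff[OF _ finite_verts, of "P i" f]
    by (simp add: weight_def neighbours_eq[OF assms])
qed

text \<open>Without zeros, the sum over a part is at least its size, hence at least 3.\<close>

lemma zero_in_light_part:
  fixes f :: "'a \<Rightarrow> nat"
  assumes "i \<in> I" "sum f (P i) \<le> 2"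
  shows "\<exists>v\<in>P i. f v = 0"
proof (rule ccontr)
  assume "\<not> (\<exists>v\<in>P i. f v = 0)"
  then have "card (P i) * 1 \<le> sum f (P i)"
    using sum_bounded_below[of "P i" 1 f] by force
  then show False
    using card_part[OF assms(1)] assms(2) by simp
qed

lemma weight_of_pid_function_with_zero:
  assumes f: "pid_function G f" and v: "v \<in> verts G" "f v = 0"
  shows "card I * weight G f = weight G f + 2 * card I"
proof -
  have zero: "weight G f = sum f (P j) + 2" if "j \<in> I" "u \<in> P j" "f u = 0" for j u
    using f that weight_eq_part_plus_neighbours[OF that(1,2), of f]
    by (auto simp: pid_function_def verts_eq)
  obtain i where i: "i \<in> I" "v \<in> P i"
    using v by (auto simp: verts_eq)
  have part: "weight G f = sum f (P j) + 2" if j: "j \<in> I" for j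
  proof (cases "j = i")
    case True
    then show ?thesis using zero i v by blast
  next
    case False
    \<comment> \<open>The zero \<open>v\<close> leaves exactly 2 for all parts other than
      \<open>P i\<close>, so \<open>P j\<close> is light and contains a zero of its own.\<close>
    have "sum f (P i) + sum f (P j) = (\<Sum>l\<in>{i, j}. sum f (P l))"
      using False by simp
    also have "\<dots> \<le> weight G f"
      unfolding weight_def sum_verts by (rule sum_mono2) (use finite_index i j in auto)
    finally have "sum f (P j) \<le> 2"
      using zero[OF i v(2)] by simp
    then show ?thesis
      using zero_in_light_part[OF j] zero[OF j] by blast
  qed
  have "card I * weight G f = (\<Sum>j\<in>I. sum f (P j) + 2)"
    using sum.cong[OF refl part, of I] by (simp only: sum_constant of_nat_id)
  also have "\<dots> = weight G f + 2 * card I"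
    unfolding sum.distrib by (simp add: weight_def sum_verts)
  finally show ?thesis .
qed

lemma card_verts: "card (verts G) = (\<Sum>i\<in>I. card (P i))"
  using sum_verts[of "\<lambda>_. 1 :: nat"] by simp

lemma card_verts_ge: "card (verts G) \<ge> 3 * card I"
  unfolding card_verts using sum_bounded_below[of I 3 "\<lambda>i. card (P i)"] card_part
  by (simp add: mult.commute)

lemma weight_cases:
  assumes "pid_function G f"
  shows "weight G f \<ge> card (verts G) \<or> card I * weight G f = weight G f + 2 * card I"
proof (cases "\<exists>v\<in>verts G. f v = 0")
  case True
  then show ?thesis
    using weight_of_pid_function_with_zero[OF assms] by blast
next
  case False
  then show ?thesis
    using sum_bounded_below[of "verts G" 1 f] by (force simp: weight_def)
qed

text \<open>The value \<open>c\<close> is put on one representative of each part.\<close>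
lemma pid_function_of_transversal:
  assumes c: "c \<in> {1, 2}" "card I * c = c + 2"
  shows "\<exists>f. pid_function G f \<and> weight G f = c + 2"
proof -
  have "\<exists>v. v \<in> P i" if "i \<in> I" for i
    using card_part[OF that] by (cases "P i = {}") auto
  then obtain r where r: "\<And>i. i \<in> I \<Longrightarrow> r i \<in> P i"
    by metis
  define f where "f v = (if v \<in> r ` I then c else 0)" for v
  have part: "sum f (P i) = c" if i: "i \<in> I" for i
  proof -
    have "f v = (if v = r i then c else 0)" if "v \<in> P i" for v
      using that i r part_unique by (auto simp: f_def)
    then have "sum f (P i) = (\<Sum>v\<in>P i. if v = r i then c else 0)"
      by (rule sum.cong[OF refl])
    then show ?thesis
      using r[OF i] finite_part[OF i] by simp
  qed
  have w: "weight G f = c + 2"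
    using part c(2) by (simp add: weight_def sum_verts)
  \<comment> \<open>This holds at every vertex, zero or not: the total \<open>c + 2\<close> loses
    the share \<open>c\<close> of the vertex's own part.\<close>
  have "sum f (neighbours G v) = 2" if v: "v \<in> verts G" for v
  proof -
    obtain i where i: "i \<in> I" "v \<in> P i"
      using v by (auto simp: verts_eq)
    show ?thesis
      using weight_eq_part_plus_neighbours[OF i, of f] w part[OF i(1)] by simp
  qed
  then have "pid_function G f"
    using c(1) by (auto simp: pid_function_def f_def)
  with w show ?thesis by blast
qed

lemma pid_number_le_card: "pid_number G \<le> card (verts G)"
  using pid_number_le[of G "\<lambda>_. 1"] by (auto simp: pid_function_def weight_def)

text \<open>Apply \<open>weight_cases\<close> to a function of minimum weight; the constant function
  1 turns its first alternative into an equality.\<close>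

lemma pid_number_cases:
  "pid_number G = card (verts G) \<or> card I * pid_number G = pid_number G + 2 * card I"
  using pid_number_attained[of G] weight_cases pid_number_le_card by force

lemma pid_number_two_parts:
  assumes "card I = 2"
  shows "pid_number G = 4"
proof -
  \<comment> \<open>With two parts, \<open>c = 2\<close> solves \<open>2 * c = c + 2\<close>. The
    bound 4 then excludes the value \<open>card (verts G)\<close>, which is at least 6.\<close>
  have "pid_number G \<le> 4"
    using pid_function_of_transversal[of 2] assms pid_number_le by fastforce
  then show ?thesis
    using pid_number_cases card_verts_ge assms by auto
qed

lemma pid_number_three_parts:
  assumes "card I = 3"
  shows "pid_number G = 3"
proof -
  \<comment> \<open>Here \<open>c = 1\<close> solves \<open>3 * c = c + 2\<close>, and there are at
    least 9 vertices.\<close>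
  have "pid_number G \<le> 3"
    using pid_function_of_transversal[of 1] assms pid_number_le by fastforce
  then show ?thesis
    using pid_number_cases card_verts_ge assms by auto
qed

lemma pid_number_many_parts:
  assumes "card I \<ge> 4"
  shows "pid_number G = card (verts G)"
proof -
  \<comment> \<open>The equation means \<open>w = 2 + 2 / (card I - 1)\<close>, which lies strictly
    between 2 and 3 when \<open>card I \<ge> 4\<close>; hence the case split.\<close>
  have "card I * w \<noteq> w + 2 * card I" for w
  proof
    assume eq: "card I * w = w + 2 * card I"
    consider "w \<le> 2" | "w \<ge> 3" by linarith
    then show False
    proof cases
      case 1
      then have "card I * w \<le> card I * 2" by simp
      then have "w = 0" using eq by linarith
      then show False using eq assms by simp
    next
      case 2
      then obtain m where m: "w = m + 3"
        using that[of "w - 3"] by simp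
      \<comment> \<open>Since \<open>m \<le> card I * m\<close>, this would force
        \<open>card I \<le> 3\<close>.\<close>
      have "card I * m + card I = m + 3"
        using eq by (simp add: m distrib_left)
      moreover have "1 * m \<le> card I * m"
        by (rule mult_right_mono) (use assms in simp_all)
      ultimately show False
        using assms by linarith
    qed
  qed
  then show ?thesis
    using pid_number_cases by blast
qed

end

theorem theorem20:
  fixes G :: "('a, 'b) pre_digraph" and k :: nat and n :: "nat \<Rightarrow> nat"
  assumes "k \<ge> 2"
    and "\<forall>i\<in>{1..k}. n i \<ge> 3"
    and "complete_multipartite_digraph k n G"
  shows "(k = 2 \<longrightarrow> pid_number G = 4) \<and>
         (k = 3 \<longrightarrow> pid_number G = 3) \<and>
         (k \<ge> 4 \<longrightarrow> pid_number G = (\<Sum>i=1..k. n i))"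
proof -
  obtain P where P: "verts G = (\<Union>i\<in>{1..k}. P i)" "disjoint_family_on P {1..k}"
      "\<forall>i\<in>{1..k}. card (P i) = n i"
      "arcs_ends G = (\<Union>i\<in>{1..k}. \<Union>j\<in>{1..k} - {i}. P i \<times> P j)"
    using assms(3) unfolding complete_multipartite_digraph_def by blast
  interpret large_multipartite G "{1..k}" P
    by unfold_locales (use P assms(2) in simp_all)
  have "card (verts G) = (\<Sum>i=1..k. n i)"
    using card_verts P(3) by simp
  then show ?thesis
    using pid_number_two_parts pid_number_three_parts pid_number_many_parts by simp
qed

end
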